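(* Let $R$ be an integral domain. The following assertions are equivalent: (a) $R$ is integrally closed; (b) every principal ideal of $R$ is integrally closed; (c) every $t$-ideal of $R$ is integrally closed; (d) $\overline{I}\subseteq I_{t}$ for each nonzero ideal $I$ of $R$; (e) every nonzero principal ideal of $R$ is $t$-integrally closed; (f) every $t$-ideal of $R$ is $t$-integrally closed; (g) $\widetilde{I}=I_{t}$ for each nonzero ideal $I$ of $R$.
   Context: All rings are commutative with identity. Let $R$ be an integral domain with quotient field $K$; $R$ is integrally closed if it is integrally closed in $K$. For a nonzero fractional ideal $I$ of $R$, put $I^{-1}:=\{x\in K\mid xI\subseteq R\}$, $I_v:=(I^{-1})^{-1}$, and $I_t:=\bigcup J_v$, where $J$ ranges over the nonzero finitely generated subideals of $I$. A nonzero ideal $I$ of $R$ is a $t$-ideal if $I_t=I$. For an ideal $I$ of $R$, the integral closure $\overline{I}$ is the set of $x\in R$ satisfying an equation $x^{n}+a_{1}x^{n-1}+\dots+a_{n-1}x+a_{n}=0$ with $n\geq 1$ and $a_i\in I^i$ for $i=1,\dots,n$; $I$ is integrally closed if $\overline{I}=I$. For a nonzero ideal $I$ of $R$, an element $x\in R$ is $t$-integral over $I$ if there is an equation $x^{n}+a_{1}x^{n-1}+\dots+a_{n-1}x+a_{n}=0$ with $n\geq 1$ and $a_{i}\in (I^{i})_{t}$ for all $i=1,\dots,n$. The $t$-integral closure $\widetilde{I}$ of $I$ is the set of all elements of $R$ that are $t$-integral over $I$; $I$ is $t$-integrally closed if $\widetilde{I}=I$. *)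

theory Defs
  imports "HOL-Computational_Algebra.Polynomial_Factorial"
begin

text \<open>
  The integral domain \<open>R\<close> is the type \<open>'a :: idom\<close> and its quotient field \<open>K\<close> is the library type
  \<open>'a fract\<close>, with canonical embedding \<^const>\<open>to_fract\<close>.  The ideals of \<open>R\<close> are the subspaces of
  \<open>R\<close> as a module over itself, and the fractional ideals are considered among the \<open>R\<close>-submodules
  of \<open>K\<close>; an ideal \<open>I\<close> of \<open>R\<close> becomes the fractional ideal \<open>to_fract ` I\<close>.
\<close>

lemma module_self: "module ((*) :: 'a::comm_ring_1 \<Rightarrow> 'a \<Rightarrow> 'a)"
  by unfold_locales (simp_all add: algebra_simps)

lemma module_fract: "module (\<lambda>(r::'a::idom) x. to_fract r * x)"
  by unfold_locales (simp_all add: algebra_simps)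

abbreviation is_ideal :: "'a::comm_ring_1 set \<Rightarrow> bool"
  where "is_ideal \<equiv> module.subspace (*)"

abbreviation ideal_gen :: "'a::comm_ring_1 set \<Rightarrow> 'a set"
  where "ideal_gen \<equiv> module.span (*)"

abbreviation frac_gen :: "'a::idom fract set \<Rightarrow> 'a fract set"
  where "frac_gen \<equiv> module.span (\<lambda>r x. to_fract r * x)"

abbreviation nonzero_ideal :: "'a::comm_ring_1 set \<Rightarrow> bool"
  where "nonzero_ideal I \<equiv> is_ideal I \<and> I \<noteq> {0}"

abbreviation principal_ideal :: "'a::comm_ring_1 set \<Rightarrow> bool"
  where "principal_ideal I \<equiv> (\<exists>a. I = ideal_gen {a})"

definition ideal_prod :: "'a::comm_ring_1 set \<Rightarrow> 'a set \<Rightarrow> 'a set"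
  where "ideal_prod I J = ideal_gen {a * b | a b. a \<in> I \<and> b \<in> J}"

primrec ideal_power :: "'a::comm_ring_1 set \<Rightarrow> nat \<Rightarrow> 'a set" where
  "ideal_power I 0 = UNIV"
| "ideal_power I (Suc n) = ideal_prod I (ideal_power I n)"

definition integral_over_domain :: "'a::idom fract \<Rightarrow> bool"
  where "integral_over_domain x \<longleftrightarrow>
    (\<exists>p :: 'a poly. lead_coeff p = 1 \<and> poly (map_poly to_fract p) x = 0)"

definition integrally_closed_domain :: "'a::idom itself \<Rightarrow> bool"
  where "integrally_closed_domain _ \<longleftrightarrow>
    (\<forall>x :: 'a fract. integral_over_domain x \<longrightarrow> x \<in> range to_fract)"

definition frac_inverse :: "'a::idom fract set \<Rightarrow> 'a fract set"
  where "frac_inverse I = {x. \<forall>y\<in>I. x * y \<in> range to_fract}"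

definition v_closure :: "'a::idom fract set \<Rightarrow> 'a fract set"
  where "v_closure I = frac_inverse (frac_inverse I)"

text \<open>The union is over the nonzero finitely generated \<open>R\<close>-submodules \<open>J\<close> of \<open>I\<close>.\<close>

definition t_closure :: "'a::idom fract set \<Rightarrow> 'a fract set"
  where "t_closure I =
    \<Union>{v_closure J | J. J \<subseteq> I \<and> J \<noteq> {0} \<and> (\<exists>B. finite B \<and> J = frac_gen B)}"

definition t_ideal :: "'a::idom set \<Rightarrow> bool"
  where "t_ideal I \<longleftrightarrow> nonzero_ideal I \<and> t_closure (to_fract ` I) = to_fract ` I"

definition integral_closure :: "'a::comm_ring_1 set \<Rightarrow> 'a set"
  where "integral_closure I =
    {x. \<exists>n\<ge>1. \<exists>a. (\<forall>i\<in>{1..n}. a i \<in> ideal_power I i) \<and>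
          x ^ n + (\<Sum>i=1..n. a i * x ^ (n - i)) = 0}"

definition integrally_closed_ideal :: "'a::comm_ring_1 set \<Rightarrow> bool"
  where "integrally_closed_ideal I \<longleftrightarrow> integral_closure I = I"

text \<open>
  Since \<open>(I\<^sup>i)\<^sub>t\<close> is formed in \<open>K\<close>, the equation of \<open>t\<close>-integrality is stated in \<open>K\<close>; the elements
  of the \<open>t\<close>-integral closure are nevertheless elements of \<open>R\<close>.
\<close>

definition t_integral_over :: "'a::idom set \<Rightarrow> 'a \<Rightarrow> bool"
  where "t_integral_over I x \<longleftrightarrow>
    (\<exists>n\<ge>1. \<exists>a. (\<forall>i\<in>{1..n}. a i \<in> t_closure (to_fract ` ideal_power I i)) \<and>
       to_fract x ^ n + (\<Sum>i=1..n. a i * to_fract x ^ (n - i)) = 0)"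

definition t_integral_closure :: "'a::idom set \<Rightarrow> 'a set"
  where "t_integral_closure I = {x. t_integral_over I x}"

definition t_integrally_closed_ideal :: "'a::idom set \<Rightarrow> bool"
  where "t_integrally_closed_ideal I \<longleftrightarrow> t_integral_closure I = I"

end

theory Submission
  imports Defs
begin

text \<open>
  The core is that over an integrally closed domain every element \<open>x\<close> that is \<open>t\<close>-integral over
  \<open>I\<close> lies in \<open>I\<^sub>t\<close>.  The coefficients \<open>a\<^sub>i \<in> (I\<^sup>i)\<^sub>t\<close> of an equation for \<open>x\<close> involve only finitely
  many elements of \<open>I\<close>; let these generate \<open>J \<subseteq> I\<close>.  If \<open>y \<in> J\<inverse>\<close>, then \<open>a\<^sub>i y\<^sup>i \<in> R\<close> for all \<open>i\<close>, and
  multiplying the equation by \<open>y\<^sup>n\<close> shows that \<open>x y\<close> is integral over \<open>R\<close>, so \<open>x y \<in> R\<close>.  Thus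
  \<open>x \<in> J\<^sub>v\<close>.  Conversely, if \<open>a / b\<close> is integral over \<open>R\<close>, then clearing denominators exhibits \<open>a\<close> as
  an element of the integral closure of \<open>(b)\<close>.
\<close>

section \<open>The embedding of the domain into its quotient field\<close>

lemma to_fract_sum: "to_fract (sum f A) = (\<Sum>i\<in>A. to_fract (f i))"
  by (induction A rule: infinite_finite_induct) simp_all

lemma to_fract_power: "to_fract (x ^ n) = to_fract x ^ n"
  by (induction n) simp_all

lemma inj_to_fract: "inj to_fract"
  by (simp add: inj_def)

lemma range_to_fract_add:
  "x \<in> range to_fract \<Longrightarrow> y \<in> range to_fract \<Longrightarrow> x + y \<in> range to_fract"
  by (auto simp del: to_fract_add simp flip: to_fract_add)

lemma range_to_fract_mult:
  "x \<in> range to_fract \<Longrightarrow> y \<in> range to_fract \<Longrightarrow> x * y \<in> range to_fract"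
  by (auto simp del: to_fract_mult simp flip: to_fract_mult)

lemma range_to_fract_zero [simp]: "0 \<in> range to_fract"
  by (metis rangeI to_fract_0)

text \<open>
  The module locale is not interpreted because its simplification rule \<open>scale_scale\<close> would loop
  against \<^term>\<open>to_fract\<close> being multiplicative and against associativity.
\<close>

lemmas ideal_span_base = module.span_base[OF module_self]
lemmas ideal_span_eq_iff = module.span_eq_iff[OF module_self]
lemmas ideal_span_induct_alt [consumes 1, case_names base step] =
  module.span_induct_alt[OF module_self]
lemmas ideal_span_mono = module.span_mono[OF module_self]
lemmas ideal_span_singleton = module.span_singleton[OF module_self]
lemmas ideal_subspace_0 = module.subspace_0[OF module_self]
lemmas ideal_subspace_neg = module.subspace_neg[OF module_self]
lemmas ideal_subspace_scale = module.subspace_scale[OF module_self]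
lemmas ideal_subspace_UNIV [simp] = module.subspace_UNIV[OF module_self]
lemmas ideal_subspace_span [simp] = module.subspace_span[OF module_self]
lemmas ideal_subspace_single_0 = module.subspace_single_0[OF module_self]
lemmas frac_span_base = module.span_base[OF module_fract]
lemmas frac_span_induct_alt [consumes 1, case_names base step] =
  module.span_induct_alt[OF module_fract]
lemmas frac_span_minimal = module.span_minimal[OF module_fract]

section \<open>Principal ideals and powers of ideals\<close>

lemma ideal_gen_single: "ideal_gen {a} = range (\<lambda>r. r * a)"
  by (rule ideal_span_singleton)

lemma nonzero_idealE:
  assumes "nonzero_ideal I"
  obtains b where "b \<in> I" "b \<noteq> 0"
  using assms ideal_subspace_0[of I] by blast

lemma ideal_power_Suc_0:
  assumes "is_ideal I"
  shows "ideal_power I (Suc 0) = I"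
proof -
  have "{a * b | a b. a \<in> I \<and> b \<in> UNIV} = I"
  proof (intro equalityI subsetI)
    fix x assume "x \<in> I"
    then show "x \<in> {a * b | a b. a \<in> I \<and> b \<in> UNIV}"
      by (intro CollectI exI[of _ x] exI[of _ 1]) simp
  qed (use ideal_subspace_scale[OF assms] in \<open>auto simp: mult.commute\<close>)
  then show ?thesis
    using assms by (simp add: ideal_prod_def ideal_span_eq_iff)
qed

lemma is_ideal_power: "is_ideal (ideal_power I n)"
  by (cases n) (simp_all add: ideal_prod_def)

lemma power_in_ideal_power: "b \<in> I \<Longrightarrow> b ^ n \<in> ideal_power I n"
  by (induction n) (auto simp: ideal_prod_def intro!: ideal_span_base)

text \<open>A domain has no zero divisors, so powers of a nonzero element of \<open>I\<close> stay
  nonzero. This makes \<open>subset_t_closure\<close> applicable to every power of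
  \<open>I\<close>.\<close>

lemma nonzero_ideal_power:
  assumes "nonzero_ideal (I :: 'a::idom set)"
  shows "nonzero_ideal (ideal_power I n)"
proof -
  obtain b where "b \<in> I" "b \<noteq> 0"
    using assms by (rule nonzero_idealE)
  then have "b ^ n \<in> ideal_power I n" "b ^ n \<noteq> 0"
    by (simp_all add: power_in_ideal_power)
  then show ?thesis
    using is_ideal_power by blast
qed

lemma ideal_power_zero: "ideal_power {0 :: 'a::comm_ring_1} (Suc n) = {0}"
proof -
  have "{a * b | a b. a \<in> {0} \<and> b \<in> ideal_power {0 :: 'a} n} \<subseteq> {0}"
    by auto
  then have "ideal_power {0} (Suc n) \<subseteq> ideal_gen {0 :: 'a}"
    unfolding ideal_power.simps ideal_prod_def by (rule ideal_span_mono)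
  moreover have "0 \<in> ideal_power {0} (Suc n)"
    using is_ideal_power ideal_subspace_0 by blast
  ultimately show ?thesis
    by (auto simp: ideal_gen_single)
qed

section \<open>Integrality as an explicit equation\<close>

lemma poly_map_to_fract_monic:
  fixes p :: "'a::idom poly"
  assumes "lead_coeff p = 1"
  shows "poly (map_poly to_fract p) x = x ^ degree p +
    (\<Sum>i=1..degree p. to_fract (coeff p (degree p - i)) * x ^ (degree p - i))"
proof -
  let ?n = "degree p"
  have "degree (map_poly to_fract p) = ?n"
    by (rule degree_map_poly) simp
  then have "poly (map_poly to_fract p) x = (\<Sum>j\<le>?n. to_fract (coeff p j) * x ^ j)"
    by (simp add: poly_altdef coeff_map_poly)
  also have "\<dots> = x ^ ?n + (\<Sum>j<?n. to_fract (coeff p j) * x ^ j)"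
    using assms by (simp add: lessThan_Suc_atMost[symmetric])
  also have "(\<Sum>j<?n. to_fract (coeff p j) * x ^ j)
      = (\<Sum>i=1..?n. to_fract (coeff p (?n - i)) * x ^ (?n - i))"
    by (rule sum.reindex_bij_witness[of _ "\<lambda>i. ?n - i" "\<lambda>i. ?n - i"]) auto
  finally show ?thesis .
qed

text \<open>Passes from monic polynomials to written-out equations, which can be multiplied term by
  term by a power of a field element.\<close>

lemma integral_over_domain_iff:
  fixes x :: "'a::idom fract"
  shows "integral_over_domain x \<longleftrightarrow>
    (\<exists>n\<ge>1. \<exists>c. x ^ n + (\<Sum>i=1..n. to_fract (c i) * x ^ (n - i)) = 0)" (is "_ \<longleftrightarrow> ?R")
proof
  assume "integral_over_domain x"
  then obtain p :: "'a poly" where p: "lead_coeff p = 1" "poly (map_poly to_fract p) x = 0"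
    unfolding integral_over_domain_def by blast
  define n where "n = degree p"
  \<comment> \<open>A monic polynomial of degree 0 is 1, which has no root.\<close>
  have n: "n \<ge> 1"
  proof (rule ccontr)
    assume "\<not> n \<ge> 1"
    then obtain k where "p = [:k:]"
      unfolding n_def by (metis degree_eq_zeroE less_one not_le)
    then have "p = 1"
      using p(1) by simp
    then show False
      using p(2) by simp
  qed
  show ?R
    using n p(2) poly_map_to_fract_monic[OF p(1), of x] unfolding n_def by metis
next
  assume ?R
  then obtain n c where n: "n \<ge> 1"
    and eq: "x ^ n + (\<Sum>i=1..n. to_fract (c i) * x ^ (n - i)) = 0"
    by blast
  \<comment> \<open>Indices are reversed: \<open>c i\<close> belongs to \<open>x ^ (n - i)\<close>.
    At \<open>j = n\<close> stands the leading coefficient 1 instead of \<open>c 0\<close>.\<close>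
  define d where "d = (\<lambda>j. if j = n then 1 else c (n - j))"
  define p where "p = (\<Sum>j\<le>n. monom (d j) j)"
  have coeff: "coeff p j = (if j \<le> n then d j else 0)" for j
    by (simp add: p_def coeff_sum if_distrib cong: if_cong)
  have "degree p = n"
  proof (rule antisym)
    show "degree p \<le> n"
      by (rule degree_le) (simp add: coeff)
    show "n \<le> degree p"
      by (rule le_degree) (simp add: coeff d_def)
  qed
  then have monic: "lead_coeff p = 1"
    by (simp add: coeff d_def)
  have "(\<Sum>i=1..n. to_fract (coeff p (n - i)) * x ^ (n - i))
      = (\<Sum>i=1..n. to_fract (c i) * x ^ (n - i))"
    by (rule sum.cong) (auto simp: coeff d_def)
  then have "poly (map_poly to_fract p) x = 0"
    using poly_map_to_fract_monic[OF monic, of x] eq \<open>degree p = n\<close> by simp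
  then show "integral_over_domain x"
    using monic unfolding integral_over_domain_def by blast
qed

section \<open>Inverses, v-closure and t-closure\<close>

lemma frac_inverse_antimono: "I \<subseteq> J \<Longrightarrow> frac_inverse J \<subseteq> frac_inverse I"
  by (auto simp: frac_inverse_def)

lemma v_closure_mono: "I \<subseteq> J \<Longrightarrow> v_closure I \<subseteq> v_closure J"
  by (simp add: v_closure_def frac_inverse_antimono)

lemma subset_v_closure: "I \<subseteq> v_closure I"
  by (auto simp: v_closure_def frac_inverse_def mult.commute)

text \<open>Testing on generators suffices, because the \<open>z\<close> with \<open>y * z\<close>
  in R form an R-submodule of K.\<close>

lemma frac_inverse_frac_gen:
  "frac_inverse (frac_gen B) = {y. \<forall>b\<in>B. y * b \<in> range to_fract}"
proof (intro equalityI subsetI CollectI ballI)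
  fix y b assume "y \<in> frac_inverse (frac_gen B)" "b \<in> B"
  then show "y * b \<in> range to_fract"
    by (auto simp: frac_inverse_def intro: frac_span_base)
next
  fix y assume y: "y \<in> {y. \<forall>b\<in>B. y * b \<in> range to_fract}"
  have "y * z \<in> range to_fract" if "z \<in> frac_gen B" for z
    using that
  proof (induction rule: frac_span_induct_alt)
    case base
    show ?case by simp
  next
    case (step c b z)
    have "y * (to_fract c * b + z) = to_fract c * (y * b) + y * z"
      by (simp add: algebra_simps)
    moreover have "y * b \<in> range to_fract" "y * z \<in> range to_fract"
      using step y by blast+
    ultimately show ?case
      by (simp only: range_to_fract_add range_to_fract_mult rangeI)
  qed
  then show "y \<in> frac_inverse (frac_gen B)"
    by (simp add: frac_inverse_def)
qed

lemma frac_gen_subset_ideal: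
  assumes "is_ideal I" "B \<subseteq> I"
  shows "frac_gen (to_fract ` B) \<subseteq> to_fract ` I"
proof (rule frac_span_minimal)
  show "module.subspace (\<lambda>r x. to_fract r * x) (to_fract ` I)"
    using assms(1) unfolding module.subspace_def[OF module_fract] module.subspace_def[OF module_self]
    by (auto simp del: to_fract_add to_fract_mult
        simp: to_fract_add[symmetric] to_fract_mult[symmetric] intro: rev_image_eqI)
qed (use assms(2) in blast)

text \<open>The nonzero \<open>b\<close> guarantees that the submodule generated by \<open>F\<close>
  is nonzero, as the union defining \<open>t_closure\<close> demands.\<close>

lemma t_closureI:
  assumes "is_ideal I" "finite F" "F \<subseteq> I" "b \<in> F" "b \<noteq> 0"
    and "x \<in> v_closure (frac_gen (to_fract ` F))"
  shows "x \<in> t_closure (to_fract ` I)"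
proof -
  have "to_fract b \<in> frac_gen (to_fract ` F)" "to_fract b \<noteq> 0"
    using assms(4,5) by (auto intro: frac_span_base)
  then have "frac_gen (to_fract ` F) \<noteq> {0}"
    by blast
  then show ?thesis
    using assms frac_gen_subset_ideal[of I F] unfolding t_closure_def by blast
qed

lemma subset_t_closure:
  assumes "nonzero_ideal I"
  shows "to_fract ` I \<subseteq> t_closure (to_fract ` I)"
proof
  fix z assume "z \<in> to_fract ` I"
  then obtain x where x: "x \<in> I" "z = to_fract x"
    by blast
  obtain b where b: "b \<in> I" "b \<noteq> 0"
    using assms by (rule nonzero_idealE)
  \<comment> \<open>The element \<open>b\<close> is adjoined because \<open>x\<close> may be
    0.\<close>
  have "z \<in> v_closure (frac_gen (to_fract ` {x, b}))"
    using x by (intro subsetD[OF subset_v_closure] frac_span_base) simp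
  then show "z \<in> t_closure (to_fract ` I)"
    using assms x b by (intro t_closureI[of I "{x, b}" b]) auto
qed

lemma t_closure_subset_v_closure: "t_closure I \<subseteq> v_closure I"
  unfolding t_closure_def by (auto dest: v_closure_mono)

text \<open>Since \<open>I\<close> lies in R, its inverse contains 1. Hence elements of the
  t-closure of an ideal come from R.\<close>

lemma v_closure_subset_range: "v_closure (to_fract ` I) \<subseteq> range to_fract"
proof
  fix x assume x: "x \<in> v_closure (to_fract ` I)"
  have "1 \<in> frac_inverse (to_fract ` I)"
    by (auto simp: frac_inverse_def)
  then have "x * 1 \<in> range to_fract"
    using x unfolding v_closure_def frac_inverse_def[of "frac_inverse _"] by blast
  then show "x \<in> range to_fract"
    by simp
qed

text \<open>If \<open>a\<close> generates \<open>I\<close>, then 1/a lies in the inverse of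
  \<open>I\<close>, so any \<open>x\<close> in the v-closure has x/a in R. The t-closure is squeezed
  between \<open>I\<close> and this v-closure.\<close>

lemma t_ideal_principal:
  assumes "principal_ideal I" "I \<noteq> {0 :: 'a::idom}"
  shows "t_ideal I"
proof -
  obtain a where I: "I = range (\<lambda>r. r * a)"
    using assms(1) by (auto simp: ideal_gen_single)
  have a: "a \<noteq> 0"
    using assms(2) I by auto
  have ideal: "nonzero_ideal I"
    using assms by auto
  have "v_closure (to_fract ` I) \<subseteq> to_fract ` I"
  proof
    fix x assume x: "x \<in> v_closure (to_fract ` I)"
    have "inverse (to_fract a) * to_fract (r * a) = to_fract r" for r
      using a by (simp add: field_simps)
    then have "inverse (to_fract a) \<in> frac_inverse (to_fract ` I)"
      by (auto simp: frac_inverse_def I simp del: to_fract_mult)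
    then have "x * inverse (to_fract a) \<in> range to_fract"
      using x unfolding v_closure_def frac_inverse_def[of "frac_inverse _"] by blast
    then obtain r where "x * inverse (to_fract a) = to_fract r"
      by blast
    then have "x = to_fract (r * a)"
      using a by (simp add: field_simps)
    then show "x \<in> to_fract ` I"
      unfolding I by blast
  qed
  then have "t_closure (to_fract ` I) = to_fract ` I"
    using t_closure_subset_v_closure subset_t_closure[OF ideal] by blast
  then show ?thesis
    using ideal by (simp add: t_ideal_def)
qed

section \<open>Control of coefficients by finitely many elements\<close>

text \<open>With J the ideal generated by \<open>F\<close>, every \<open>c\<close> in (J^n)_v has
  this property. It is stated through the inverse of J alone, the form in which it is used when an
  equation is multiplied by y^n.\<close>

definition controls :: "'a::idom set \<Rightarrow> nat \<Rightarrow> 'a fract \<Rightarrow> bool"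
  where "controls F n c \<longleftrightarrow>
    (\<forall>y\<in>frac_inverse (to_fract ` F). c * y ^ n \<in> range to_fract)"

lemma controls_mono: "controls F n c \<Longrightarrow> F \<subseteq> G \<Longrightarrow> controls G n c"
  unfolding controls_def using frac_inverse_antimono[OF image_mono] by blast

text \<open>Induction on \<open>n\<close>, and inside it on the generation of the ideal product: a
  product a*b with \<open>b\<close> in I^n is handled by y^(n+1) a b = (y a)(y^n b), a sum by
  uniting the finite sets.\<close>

lemma ideal_power_controls:
  fixes z :: "'a::idom"
  assumes "z \<in> ideal_power I n"
  shows "\<exists>F. finite F \<and> F \<subseteq> I \<and> controls F n (to_fract z)"
  using assms
proof (induction n arbitrary: z)
  case 0
  show ?case
    by (intro exI[of _ "{}"]) (simp add: controls_def)
next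
  case (Suc n)
  have "z \<in> ideal_gen {a * b | a b. a \<in> I \<and> b \<in> ideal_power I n}"
    using Suc.prems by (simp add: ideal_prod_def)
  then show ?case
  proof (induction rule: ideal_span_induct_alt)
    case base
    show ?case
      by (intro exI[of _ "{}"]) (simp add: controls_def)
  next
    case (step c ab z)
    from step.IH obtain G where G: "finite G" "G \<subseteq> I" "controls G (Suc n) (to_fract z)"
      by blast
    from step.hyps obtain a b where ab: "ab = a * b" "a \<in> I" "b \<in> ideal_power I n"
      by blast
    from Suc.IH[OF ab(3)] obtain F where F: "finite F" "F \<subseteq> I" "controls F n (to_fract b)"
      by blast
    \<comment> \<open>Including \<open>a\<close> itself forces \<open>y * to_fract a\<close> into R
      for every \<open>y\<close> in the inverse of \<open>H\<close>.\<close>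
    define H where "H = insert a F \<union> G"
    have H: "controls H n (to_fract b)" "controls H (Suc n) (to_fract z)"
      by (rule controls_mono[OF F(3)] controls_mono[OF G(3)]; auto simp: H_def)+
    have "controls H (Suc n) (to_fract (c * ab + z))"
      unfolding controls_def
    proof
      fix y assume y: "y \<in> frac_inverse (to_fract ` H)"
      then have "y * to_fract a \<in> range to_fract"
        by (simp add: frac_inverse_def H_def)
      moreover have "to_fract b * y ^ n \<in> range to_fract"
        "to_fract z * y ^ Suc n \<in> range to_fract"
        using H y unfolding controls_def by blast+
      moreover have "to_fract (c * ab + z) * y ^ Suc n =
          to_fract c * ((y * to_fract a) * (to_fract b * y ^ n)) + to_fract z * y ^ Suc n"
        by (simp add: ab(1) algebra_simps)
      ultimately show "to_fract (c * ab + z) * y ^ Suc n \<in> range to_fract"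
        by (simp only: range_to_fract_add range_to_fract_mult rangeI)
    qed
    moreover have "finite H" "H \<subseteq> I"
      using F G ab(2) by (auto simp: H_def)
    ultimately show ?case
      by blast
  qed
qed

text \<open>Only finitely many generators \<open>B\<close> are involved, so their controlling sets
  have a finite union. For \<open>y\<close> in its inverse, y^n lies in the inverse of the module
  generated by \<open>B\<close>, and \<open>c\<close> in the v-closure multiplies that inverse into
  R.\<close>

lemma t_closure_ideal_power_controls:
  fixes I :: "'a::idom set"
  assumes "c \<in> t_closure (to_fract ` ideal_power I n)"
  shows "\<exists>F. finite F \<and> F \<subseteq> I \<and> controls F n c"
proof -
  obtain B where B: "finite B" "frac_gen B \<subseteq> to_fract ` ideal_power I n"
    and c: "c \<in> v_closure (frac_gen B)"
    using assms unfolding t_closure_def by blast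
  have "\<forall>b\<in>B. \<exists>F. finite F \<and> F \<subseteq> I \<and> controls F n b"
  proof
    fix b assume "b \<in> B"
    then have "b \<in> to_fract ` ideal_power I n"
      using B(2) frac_span_base by blast
    then show "\<exists>F. finite F \<and> F \<subseteq> I \<and> controls F n b"
      by (elim imageE) (simp only: ideal_power_controls)
  qed
  then obtain F where F: "\<And>b. b \<in> B \<Longrightarrow> finite (F b)" "\<And>b. b \<in> B \<Longrightarrow> F b \<subseteq> I"
    "\<And>b. b \<in> B \<Longrightarrow> controls (F b) n b"
    by metis
  let ?G = "\<Union> (F ` B)"
  have G: "controls ?G n b" if "b \<in> B" for b
    by (rule controls_mono[OF F(3)]) (use that in auto)
  have "controls ?G n c"
    unfolding controls_def
  proof
    fix y assume "y \<in> frac_inverse (to_fract ` ?G)"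
    then have "\<forall>b\<in>B. y ^ n * b \<in> range to_fract"
      using G unfolding controls_def by (simp add: mult.commute)
    then have "y ^ n \<in> frac_inverse (frac_gen B)"
      by (simp add: frac_inverse_frac_gen)
    then show "c * y ^ n \<in> range to_fract"
      using c unfolding v_closure_def frac_inverse_def[of "frac_inverse _"] by blast
  qed
  moreover have "finite ?G" "?G \<subseteq> I"
    using B(1) F(1,2) by blast+
  ultimately show ?thesis
    by blast
qed

section \<open>t-integral elements over an integrally closed domain\<close>

lemma t_integral_closure_subset_t_closure:
  fixes I :: "'a::idom set"
  assumes closed: "integrally_closed_domain TYPE('a)" and I: "nonzero_ideal I"
  shows "to_fract ` t_integral_closure I \<subseteq> t_closure (to_fract ` I)"
proof (rule image_subsetI)
  fix x assume "x \<in> t_integral_closure I"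
  then obtain n a where n: "n \<ge> 1"
    and a: "\<And>i. i \<in> {1..n} \<Longrightarrow> a i \<in> t_closure (to_fract ` ideal_power I i)"
    and eq: "to_fract x ^ n + (\<Sum>i=1..n. a i * to_fract x ^ (n - i)) = 0"
    unfolding t_integral_closure_def t_integral_over_def by blast
  have "\<forall>i\<in>{1..n}. \<exists>F. finite F \<and> F \<subseteq> I \<and> controls F i (a i)"
    using t_closure_ideal_power_controls[OF a] by blast
  then obtain F where F: "\<And>i. i \<in> {1..n} \<Longrightarrow> finite (F i)" "\<And>i. i \<in> {1..n} \<Longrightarrow> F i \<subseteq> I"
    "\<And>i. i \<in> {1..n} \<Longrightarrow> controls (F i) i (a i)"
    by metis
  obtain b where b: "b \<in> I" "b \<noteq> 0"
    using I by (rule nonzero_idealE)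
  \<comment> \<open>Adjoining \<open>b\<close> keeps the generated submodule nonzero even if all
    \<open>F i\<close> are empty or contain only 0.\<close>
  define G where "G = insert b (\<Union> (F ` {1..n}))"
  have "finite G" "G \<subseteq> I"
    unfolding G_def using b(1) F(1) F(2) by blast+
  have "to_fract x * y \<in> range to_fract" if "y \<in> frac_inverse (frac_gen (to_fract ` G))" for y
  proof -
    have "\<exists>c. a i * y ^ i = to_fract c" if i: "i \<in> {1..n}" for i
    proof -
      have "controls G i (a i)"
        by (rule controls_mono[OF F(3)[OF i]]) (use i in \<open>auto simp: G_def\<close>)
      moreover have "y \<in> frac_inverse (to_fract ` G)"
        using \<open>y \<in> _\<close> by (rule subsetD[OF frac_inverse_antimono, rotated])
          (auto intro: frac_span_base)
      ultimately show ?thesis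
        unfolding controls_def by blast
    qed
    then obtain c where c: "\<And>i. i \<in> {1..n} \<Longrightarrow> a i * y ^ i = to_fract (c i)"
      by metis
    \<comment> \<open>Of the \<open>n\<close> factors \<open>y\<close>, the coefficient
      \<open>a i\<close> absorbs \<open>i\<close> and becomes \<open>c i\<close>; the other
      \<open>n - i\<close> join the power of \<open>x\<close>.\<close>
    have "to_fract (c i) * (to_fract x * y) ^ (n - i) = y ^ n * (a i * to_fract x ^ (n - i))"
      if i: "i \<in> {1..n}" for i
    proof -
      have "y ^ n = y ^ i * y ^ (n - i)"
        using i by (simp flip: power_add)
      then show ?thesis
        by (simp add: c[OF i, symmetric] power_mult_distrib algebra_simps)
    qed
    then have "(\<Sum>i=1..n. to_fract (c i) * (to_fract x * y) ^ (n - i))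
        = y ^ n * (\<Sum>i=1..n. a i * to_fract x ^ (n - i))"
      unfolding sum_distrib_left by (rule sum.cong[OF refl])
    then have "(to_fract x * y) ^ n + (\<Sum>i=1..n. to_fract (c i) * (to_fract x * y) ^ (n - i))
        = y ^ n * (to_fract x ^ n + (\<Sum>i=1..n. a i * to_fract x ^ (n - i)))"
      by (simp add: power_mult_distrib distrib_left mult.commute)
    then have "integral_over_domain (to_fract x * y)"
      using n unfolding integral_over_domain_iff eq by auto
    then show ?thesis
      using closed unfolding integrally_closed_domain_def by blast
  qed
  then have "to_fract x \<in> v_closure (frac_gen (to_fract ` G))"
    unfolding v_closure_def frac_inverse_def[of "frac_inverse _"] by blast
  then show "to_fract x \<in> t_closure (to_fract ` I)"
    using I b \<open>finite G\<close> \<open>G \<subseteq> I\<close> by (intro t_closureI[of I G b]) (auto simp: G_def)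
qed

section \<open>Comparison of the closures\<close>

lemma subset_integral_closure:
  assumes "is_ideal I"
  shows "I \<subseteq> integral_closure I"
proof
  fix x assume x: "x \<in> I"
  \<comment> \<open>The equation of degree one satisfied by \<open>x\<close> has the coefficient
    \<open>- x\<close>.\<close>
  have "- x \<in> ideal_power I 1"
    using x ideal_subspace_neg[OF assms] ideal_power_Suc_0[OF assms] by simp
  then show "x \<in> integral_closure I"
    unfolding integral_closure_def
    by (intro CollectI exI[of _ "1::nat"] exI[of _ "\<lambda>_. - x"] conjI)
      (simp_all del: ideal_power.simps)
qed

text \<open>The zero ideal is principal but not a t-ideal, so (b) requires it separately. All
  coefficients vanish, leaving x^n = 0 in a domain.\<close>

lemma integrally_closed_zero: "integrally_closed_ideal {0 :: 'a::idom}"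
proof -
  have "x = 0" if x: "x \<in> integral_closure {0 :: 'a}" for x
  proof -
    obtain n a where n: "n \<ge> 1" and a: "\<forall>i\<in>{1..n}. a i \<in> ideal_power {0} i"
      and eq: "x ^ n + (\<Sum>i=1..n. a i * x ^ (n - i)) = 0"
      using x unfolding integral_closure_def by blast
    have "a i = 0" if "i \<in> {1..n}" for i
      \<comment> \<open>The shift to \<open>i - 1\<close> matches the successor form of
        \<open>ideal_power_zero\<close>; the zeroth power of the zero ideal is R.\<close>
      using that a ideal_power_zero[of "i - 1"] by fastforce
    then have "x ^ n = 0"
      using eq by simp
    then show ?thesis
      by simp
  qed
  then show ?thesis
    using subset_integral_closure[of "{0 :: 'a}"]
    by (auto simp: integrally_closed_ideal_def ideal_subspace_single_0)
qed

text \<open>The powers of \<open>I\<close> lie in their t-closures, so the embedded equation serves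
  as an equation of t-integrality.\<close>

lemma integral_closure_subset_t_integral_closure:
  assumes "nonzero_ideal (I :: 'a::idom set)"
  shows "integral_closure I \<subseteq> t_integral_closure I"
proof
  fix x assume "x \<in> integral_closure I"
  then obtain n a where n: "n \<ge> 1" and a: "\<And>i. i \<in> {1..n} \<Longrightarrow> a i \<in> ideal_power I i"
    and eq: "x ^ n + (\<Sum>i=1..n. a i * x ^ (n - i)) = 0"
    unfolding integral_closure_def by blast
  have "to_fract (a i) \<in> t_closure (to_fract ` ideal_power I i)" if "i \<in> {1..n}" for i
    using subset_t_closure[OF nonzero_ideal_power[OF assms]] a[OF that] by blast
  moreover have "to_fract x ^ n + (\<Sum>i=1..n. to_fract (a i) * to_fract x ^ (n - i)) = 0"
    using arg_cong[OF eq, of to_fract] by (simp add: to_fract_sum to_fract_power)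
  ultimately show "x \<in> t_integral_closure I"
    unfolding t_integral_closure_def t_integral_over_def using n
    by (intro CollectI exI[of _ n] exI[of _ "\<lambda>i. to_fract (a i)"] conjI) auto
qed

text \<open>Each v-closure is closed under negation, so the same finitely generated submodule serves
  for \<open>- x\<close>.\<close>

lemma uminus_t_closure:
  assumes "x \<in> t_closure I"
  shows "- x \<in> t_closure I"
proof -
  have "- y \<in> range to_fract" if "y \<in> range to_fract" for y :: "'a fract"
    using that by (auto simp del: to_fract_uminus simp flip: to_fract_uminus)
  then have "- x \<in> v_closure J" if "x \<in> v_closure J" for J
    using that by (simp add: v_closure_def frac_inverse_def[of "frac_inverse _"])
  then show ?thesis
    using assms unfolding t_closure_def by blast
qed

text \<open>An element of the t-closure comes from some \<open>x\<close> in R and satisfies X - x =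
  0, whose coefficient \<open>- x\<close> lies in the t-closure of the first power of
  \<open>I\<close>.\<close>

lemma t_closure_subset_t_integral_closure:
  assumes "is_ideal (I :: 'a::idom set)"
  shows "t_closure (to_fract ` I) \<subseteq> to_fract ` t_integral_closure I"
proof
  fix z assume z: "z \<in> t_closure (to_fract ` I)"
  then obtain x where x: "z = to_fract x"
    using t_closure_subset_v_closure v_closure_subset_range by blast
  have "- to_fract x \<in> t_closure (to_fract ` ideal_power I 1)"
    using z x uminus_t_closure ideal_power_Suc_0[OF assms] by simp
  then have "x \<in> t_integral_closure I"
    unfolding t_integral_closure_def t_integral_over_def
    by (intro CollectI exI[of _ "1::nat"] exI[of _ "\<lambda>_. - to_fract x"] conjI)
      (simp_all del: ideal_power.simps)
  then show "z \<in> to_fract ` t_integral_closure I"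
    using x by blast
qed

section \<open>From principal ideals back to the domain\<close>

lemma integrally_closed_domain_if_principal:
  assumes "\<And>I :: 'a::idom set. principal_ideal I \<Longrightarrow> integrally_closed_ideal I"
  shows "integrally_closed_domain TYPE('a)"
  unfolding integrally_closed_domain_def
proof (intro allI impI)
  fix x :: "'a fract"
  assume "integral_over_domain x"
  then obtain n c where n: "n \<ge> 1"
    and eq: "x ^ n + (\<Sum>i=1..n. to_fract (c i) * x ^ (n - i)) = 0"
    unfolding integral_over_domain_iff by blast
  obtain a b where b: "b \<noteq> 0" and x: "x = Fract a b"
    by (cases x) auto
  have a: "to_fract a = x * to_fract b"
    using b by (simp add: x Fract_conv_to_fract)
  \<comment> \<open>Multiplication by b^n turns x^(n-i) into a^(n-i) and leaves b^i, which puts the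
    new coefficient into the \<open>i\<close>-th power of (b).\<close>
  have "to_fract (c i * b ^ i * a ^ (n - i)) = to_fract b ^ n * (to_fract (c i) * x ^ (n - i))"
    if i: "i \<in> {1..n}" for i
  proof -
    have "to_fract b ^ n = to_fract b ^ i * to_fract b ^ (n - i)"
      using i by (simp flip: power_add)
    then show ?thesis
      by (simp add: to_fract_power a power_mult_distrib algebra_simps)
  qed
  then have "to_fract (\<Sum>i=1..n. c i * b ^ i * a ^ (n - i))
      = to_fract b ^ n * (\<Sum>i=1..n. to_fract (c i) * x ^ (n - i))"
    unfolding to_fract_sum sum_distrib_left by (rule sum.cong[OF refl])
  then have "to_fract (a ^ n + (\<Sum>i=1..n. c i * b ^ i * a ^ (n - i)))
      = to_fract b ^ n * (x ^ n + (\<Sum>i=1..n. to_fract (c i) * x ^ (n - i)))"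
    by (simp only: to_fract_add to_fract_power a power_mult_distrib distrib_left mult.commute)
  then have "a ^ n + (\<Sum>i=1..n. c i * b ^ i * a ^ (n - i)) = 0"
    by (simp only: eq mult_zero_right to_fract_eq_0_iff)
  moreover have "c i * b ^ i \<in> ideal_power (ideal_gen {b}) i" for i
    by (intro ideal_subspace_scale is_ideal_power power_in_ideal_power ideal_span_base) simp
  ultimately have "a \<in> integral_closure (ideal_gen {b})"
    unfolding integral_closure_def using n
    by (intro CollectI exI[of _ n] exI[of _ "\<lambda>i. c i * b ^ i"] conjI) auto
  then have "a \<in> ideal_gen {b}"
    using assms[of "ideal_gen {b}"] by (auto simp: integrally_closed_ideal_def)
  then obtain r where "a = r * b"
    by (auto simp: ideal_gen_single)
  then have "x = to_fract r"
    using a b by simp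
  then show "x \<in> range to_fract"
    by blast
qed

section \<open>The equivalences\<close>

theorem theorem3p5:
  shows
   "(integrally_closed_domain TYPE('a::idom) \<longleftrightarrow>
      (\<forall>I::'a set. principal_ideal I \<longrightarrow> integrally_closed_ideal I)) \<and>
    (integrally_closed_domain TYPE('a) \<longleftrightarrow>
      (\<forall>I::'a set. t_ideal I \<longrightarrow> integrally_closed_ideal I)) \<and>
    (integrally_closed_domain TYPE('a) \<longleftrightarrow>
      (\<forall>I::'a set. nonzero_ideal I \<longrightarrow>
         to_fract ` integral_closure I \<subseteq> t_closure (to_fract ` I))) \<and>
    (integrally_closed_domain TYPE('a) \<longleftrightarrow>
      (\<forall>I::'a set. principal_ideal I \<and> I \<noteq> {0} \<longrightarrow> t_integrally_closed_ideal I)) \<and>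
    (integrally_closed_domain TYPE('a) \<longleftrightarrow>
      (\<forall>I::'a set. t_ideal I \<longrightarrow> t_integrally_closed_ideal I)) \<and>
    (integrally_closed_domain TYPE('a) \<longleftrightarrow>
      (\<forall>I::'a set. nonzero_ideal I \<longrightarrow>
         to_fract ` t_integral_closure I = t_closure (to_fract ` I)))"
proof -
  let ?a = "integrally_closed_domain TYPE('a)"
  let ?b = "\<forall>I::'a set. principal_ideal I \<longrightarrow> integrally_closed_ideal I"
  let ?c = "\<forall>I::'a set. t_ideal I \<longrightarrow> integrally_closed_ideal I"
  let ?d = "\<forall>I::'a set. nonzero_ideal I \<longrightarrow>
    to_fract ` integral_closure I \<subseteq> t_closure (to_fract ` I)"
  let ?e = "\<forall>I::'a set. principal_ideal I \<and> I \<noteq> {0} \<longrightarrow> t_integrally_closed_ideal I"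
  let ?f = "\<forall>I::'a set. t_ideal I \<longrightarrow> t_integrally_closed_ideal I"
  let ?g = "\<forall>I::'a set. nonzero_ideal I \<longrightarrow>
    to_fract ` t_integral_closure I = t_closure (to_fract ` I)"
  \<comment> \<open>The implications (a), (g), (f), (e), (b), (a) close a cycle; (d) and (c) join it
    along the second path (g), (d), (c), (b).\<close>
  have ag: ?g if ?a
    using t_integral_closure_subset_t_closure[OF that] t_closure_subset_t_integral_closure
    by blast
  have gf: ?f if ?g
    unfolding t_ideal_def t_integrally_closed_ideal_def
    using that by (metis inj_image_eq_iff[OF inj_to_fract])
  have fe: ?e if ?f
    using that t_ideal_principal by blast
  have eb: ?b if ?e
  proof (intro allI impI)
    fix I :: "'a set" assume I: "principal_ideal I"
    show "integrally_closed_ideal I"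
    proof (cases "I = {0}")
      case False
      then have ideal: "nonzero_ideal I" and "t_integral_closure I = I"
        using I that by (auto simp: t_integrally_closed_ideal_def)
      then show ?thesis
        using integral_closure_subset_t_integral_closure[OF ideal] subset_integral_closure[of I]
        by (simp add: integrally_closed_ideal_def)
    qed (simp add: integrally_closed_zero)
  qed
  have ba: ?a if ?b
    using that integrally_closed_domain_if_principal by blast
  have gd: ?d if ?g
    using that integral_closure_subset_t_integral_closure by blast
  have dc: ?c if ?d
  proof (intro allI impI)
    fix I :: "'a set" assume "t_ideal I"
    then have ideal: "nonzero_ideal I" and "t_closure (to_fract ` I) = to_fract ` I"
      by (simp_all add: t_ideal_def)
    \<comment> \<open>By (d), since the t-closure of a t-ideal is the ideal itself; injectivity of
      the embedding then brings the inclusion back to R.\<close>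
    then have "to_fract ` integral_closure I \<subseteq> to_fract ` I"
      using that by metis
    then have "integral_closure I \<subseteq> I"
      by (simp only: inj_image_subset_iff[OF inj_to_fract])
    then show "integrally_closed_ideal I"
      using ideal subset_integral_closure by (auto simp: integrally_closed_ideal_def)
  qed
  have cb: ?b if ?c
    using that t_ideal_principal integrally_closed_zero by metis
  from ag gf fe eb ba gd dc cb show ?thesis
    by argo
qed

end
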